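(* Fix the grid $\mathcal{T}^n$. Let $\mathcal{T}^{n+m}=\mathcal{T}^n\cup\{s_1<s_2<\dots<s_m\}$, where $s_i\in(x_n,1)$. Then the intersection $Q_i$ of $u^n$ and $u^{n+m}$ in the interval $(x_{i-1},x_i)$ is independent of $m$ and of the distribution of $\{s_i\}$ for any $i=2,3,\dots,n$.
   Context: Consider the boundary value problem $-\varepsilon u''-bu'+cu=f$ for $x\in[0,1]$, $u(0)=u(1)=0$, where $b\le 0$, $c\ge 0$ and $0<\varepsilon\ll 1$ are constants, and $b,c$ are not both $0$. Let $H^1=\{v: v,v'\in L^2\}$ and $H_0^1=\{v\in H^1: v(0)=v(1)=0\}$, let $(\cdot,\cdot)$ be the $L^2$ inner product on $[0,1]$, and let $a(u,v)=\varepsilon(u',v')+b(u,v')+c(u,v)$. The weak solution is $u\in H_0^1$ with $a(u,v)=(f,v)$ for all $v\in H_0^1$. It is assumed that $u$ has a boundary layer at $x=1$ (a small interval, of length depending on $\varepsilon$, in which $u''$ varies rapidly) and that $x_n$ is located outside the boundary layer. Here $n\ge 2$ and $\mathcal{T}^n=\{0=x_0<x_1<\dots<x_n<x_{n+1}=1\}$ is an arbitrary grid. For a grid $\mathcal{T}$ of $[0,1]$, the finite element space is the set of continuous functions on $[0,1]$ that are affine between consecutive nodes of $\mathcal{T}$ and vanish at $0$ and $1$ (the span of the nodal hat functions at the interior nodes). The finite element solution on $\mathcal{T}$ is the unique function $u_{\mathcal{T}}$ in this space with $a(u_{\mathcal{T}},v)=(f,v)$ for all $v$ in this space. $u^n$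 and $u^{n+m}$ denote the finite element solutions on $\mathcal{T}^n$ and $\mathcal{T}^{n+m}$. $Q_i$ denotes the intersection (point) of the graphs of $u^n$ and $u^{n+m}$ in the interval $(x_{i-1},x_i)$. *)

theory Defs
  imports "HOL-Analysis.Analysis"
begin

text \<open>Functions on \<open>[0,1]\<close> are total functions on the reals; only their values on
  \<open>[0,1]\<close> matter below.\<close>

definition l2_function :: "(real \<Rightarrow> real) \<Rightarrow> bool" where
  "l2_function f \<longleftrightarrow> set_borel_measurable lebesgue {0..1} f \<and>
     set_integrable lebesgue {0..1} (\<lambda>t. (f t)\<^sup>2)"

definition l2_inner :: "(real \<Rightarrow> real) \<Rightarrow> (real \<Rightarrow> real) \<Rightarrow> real" where
  "l2_inner u v = (LINT t:{0..1}|lebesgue. u t * v t)"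

text \<open>For continuous piecewise affine functions the classical derivative exists off the
  finitely many nodes and coincides there with the weak derivative; the unspecified value of
  \<open>deriv\<close> at the nodes does not affect the integrals.\<close>

definition bilinear_form ::
    "real \<Rightarrow> real \<Rightarrow> real \<Rightarrow> (real \<Rightarrow> real) \<Rightarrow> (real \<Rightarrow> real) \<Rightarrow> real" where
  "bilinear_form \<epsilon> b c u v =
     \<epsilon> * l2_inner (deriv u) (deriv v) + b * l2_inner u (deriv v) + c * l2_inner u v"

definition grid :: "nat \<Rightarrow> (nat \<Rightarrow> real) \<Rightarrow> bool" where
  "grid n x \<longleftrightarrow> x 0 = 0 \<and> x (n + 1) = 1 \<and> strict_mono_on {0..n + 1} x"

definition grid_nodes :: "nat \<Rightarrow> (nat \<Rightarrow> real) \<Rightarrow> real set" where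
  "grid_nodes n x = x ` {0..n + 1}"

definition new_nodes :: "real \<Rightarrow> nat \<Rightarrow> (nat \<Rightarrow> real) \<Rightarrow> bool" where
  "new_nodes p m s \<longleftrightarrow> 1 \<le> m \<and> strict_mono_on {1..m} s \<and> s ` {1..m} \<subseteq> {p<..<1}"

definition consecutive :: "real set \<Rightarrow> real \<Rightarrow> real \<Rightarrow> bool" where
  "consecutive T p q \<longleftrightarrow> p \<in> T \<and> q \<in> T \<and> p < q \<and> T \<inter> {p<..<q} = {}"

definition fe_space :: "real set \<Rightarrow> (real \<Rightarrow> real) set" where
  "fe_space T = {v. continuous_on {0..1} v \<and> v 0 = 0 \<and> v 1 = 0 \<and>
     (\<forall>p q. consecutive T p q \<longrightarrow> (\<exists>\<alpha> \<beta>. \<forall>t\<in>{p..q}. v t = \<alpha> + \<beta> * t))}"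

text \<open>For \<open>\<epsilon> > 0\<close> and \<open>c \<ge> 0\<close> the form is coercive, so the finite element solution is
  unique as a function on \<open>[0,1]\<close>; off \<open>[0,1]\<close> it is left unspecified, hence a predicate.\<close>

definition fe_solution ::
    "real \<Rightarrow> real \<Rightarrow> real \<Rightarrow> (real \<Rightarrow> real) \<Rightarrow> real set \<Rightarrow> (real \<Rightarrow> real) \<Rightarrow> bool" where
  "fe_solution \<epsilon> b c f T u \<longleftrightarrow>
     u \<in> fe_space T \<and> (\<forall>v\<in>fe_space T. bilinear_form \<epsilon> b c u v = l2_inner f v)"

definition graph_over :: "real set \<Rightarrow> (real \<Rightarrow> real) \<Rightarrow> (real \<times> real) set" where
  "graph_over I u = (\<lambda>t. (t, u t)) ` I"

end

theory Submission
  imports Defs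
begin

text \<open>
  Write \<open>w = u_nm - u_n\<close> and \<open>w' = u_nm' - u_n\<close>.  The intersections of the graphs are the zeros of
  these differences, so it suffices that \<open>w\<close> and \<open>w'\<close> are proportional on \<open>[0, x n]\<close>.

  No node is added to the left of \<open>x n\<close>.  Hence both differences are piecewise affine there with
  respect to the old grid, and by Galerkin orthogonality both are \<open>a\<close>-orthogonal to every finite
  element function on the old grid that vanishes on \<open>[x n, 1]\<close>.  A function with these two
  properties that vanishes at \<open>0\<close> is determined on \<open>[0, x n]\<close> by its value at \<open>x n\<close>: if that value
  is \<open>0\<close>, the function cut off at \<open>x n\<close> is itself an admissible test function, and coercivity
  of \<open>a\<close> forces it to vanish (lemma \<open>vanishes_if_orthogonal_to_truncation\<close>).  Applied to the
  combination \<open>w' (x n) * w - w (x n) * w'\<close>, this yields \<open>w' (x n) * w = w (x n) * w'\<close> on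
  \<open>[0, x n]\<close>.  The constants are nonzero, since \<open>w (x n) = 0\<close> would make \<open>w\<close> vanish on the whole
  cell, against the intersection being one point, and \<open>w' (x n) = 0\<close> would make the graphs of
  \<open>u_n\<close> and \<open>u_nm'\<close> coincide there.

  The argument works with coercivity of \<open>a\<close> rather than with the three-term recurrence of the
  nodal values, because the off-diagonal entries of the stiffness matrix may vanish on coarse
  grids.
\<close>

section \<open>Meshes and piecewise affine functions\<close>

definition mesh :: "real set \<Rightarrow> bool" where
  "mesh T \<longleftrightarrow> finite T \<and> 0 \<in> T \<and> 1 \<in> T \<and> T \<subseteq> {0..1}"

definition cells :: "real set \<Rightarrow> real set" where
  "cells T = {0<..<1} - T"

lemma mesh_grid_nodes:
  assumes "grid n x"
  shows "mesh (grid_nodes n x)"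
proof -
  have m: "strict_mono_on {0..n+1} x" and x0: "x 0 = 0" and x1: "x (n+1) = 1"
    using assms by (auto simp: grid_def)
  have "x j \<in> {0..1}" if "j \<le> n+1" for j
    using strict_mono_on_leD[OF m, of 0 j] strict_mono_on_leD[OF m, of j "n+1"] x0 x1 that by auto
  moreover have "0 \<in> x ` {0..n+1}" using x0 by (metis atLeastAtMost_iff image_eqI le0)
  moreover have "1 \<in> x ` {0..n+1}" using x1 by (metis atLeastAtMost_iff image_eqI le0 le_refl)
  ultimately show ?thesis
    unfolding mesh_def grid_nodes_def by auto
qed

lemma mesh_Un:
  assumes "mesh T" "finite S" "S \<subseteq> {0..1}"
  shows "mesh (T \<union> S)"
  using assms by (auto simp: mesh_def)

lemma consecutive_around:
  assumes "mesh T" "t \<in> cells T"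
  obtains p q where "consecutive T p q" "p < t" "t < q"
proof -
  let ?L = "{r\<in>T. r < t}" and ?R = "{r\<in>T. t < r}"
  have fin: "finite ?L" "finite ?R" and ne: "?L \<noteq> {}" "?R \<noteq> {}"
    using assms by (auto simp: mesh_def cells_def)
  have L: "Max ?L \<in> ?L" and R: "Min ?R \<in> ?R"
    using Max_in[OF fin(1) ne(1)] Min_in[OF fin(2) ne(2)] by auto
  have "r \<notin> {Max ?L<..<Min ?R}" if "r \<in> T" for r
  proof (cases "r < t")
    case True
    then show ?thesis using Max_ge[OF fin(1), of r] that by auto
  next
    case False
    moreover have "r \<noteq> t" using that assms by (auto simp: cells_def)
    ultimately show ?thesis using Min_le[OF fin(2), of r] that by auto
  qed
  then have "consecutive T (Max ?L) (Min ?R)"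
    using L R by (auto simp: consecutive_def)
  then show ?thesis using that L R by blast
qed

lemma fe_space_mono:
  assumes "mesh T" "mesh T'" "T \<subseteq> T'" "v \<in> fe_space T"
  shows "v \<in> fe_space T'"
proof -
  have "\<exists>\<alpha> \<beta>. \<forall>t\<in>{p..q}. v t = \<alpha> + \<beta> * t" if pq: "consecutive T' p q" for p q
  proof -
    have pq': "p < q" "p \<in> T'" "q \<in> T'" "T' \<inter> {p<..<q} = {}" "0 \<le> p" "q \<le> 1"
      using pq assms by (auto simp: consecutive_def mesh_def)
    \<comment> \<open>The midpoint of a fine interval is a node of neither mesh, so it singles out the coarse
      interval around it, which must contain the whole fine one.\<close>
    then have "(p + q) / 2 \<in> {p<..<q}" by auto
    then have "(p + q) / 2 \<in> cells T"
      using pq' assms(3) by (auto simp: cells_def)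
    then obtain P Q where PQ: "consecutive T P Q" "P < (p + q) / 2" "(p + q) / 2 < Q"
      using consecutive_around assms(1) by blast
    then have "P \<in> T'" "Q \<in> T'" using assms by (auto simp: consecutive_def)
    then have "P \<notin> {p<..<q}" "Q \<notin> {p<..<q}" using pq'(4) by blast+
    then have "P \<le> p" "q \<le> Q" using PQ pq' by auto
    then have "{p..q} \<subseteq> {P..Q}" by auto
    then show ?thesis using PQ(1) assms(4) unfolding fe_space_def by blast
  qed
  then show ?thesis using assms(4) by (auto simp: fe_space_def)
qed

lemma fe_space_lincomb:
  assumes "u \<in> fe_space T" "v \<in> fe_space T"
  shows "(\<lambda>t. a * u t + d * v t) \<in> fe_space T"
proof -
  have "\<exists>\<alpha> \<beta>. \<forall>t\<in>{p..q}. a * u t + d * v t = \<alpha> + \<beta> * t" if "consecutive T p q" for p q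
  proof -
    obtain \<alpha> \<beta> \<alpha>' \<beta>' where "\<forall>t\<in>{p..q}. u t = \<alpha> + \<beta> * t" "\<forall>t\<in>{p..q}. v t = \<alpha>' + \<beta>' * t"
      using assms \<open>consecutive T p q\<close> unfolding fe_space_def by blast
    then have "\<forall>t\<in>{p..q}. a * u t + d * v t = (a*\<alpha> + d*\<alpha>') + (a*\<beta> + d*\<beta>') * t"
      by (simp add: algebra_simps)
    then show ?thesis by blast
  qed
  then show ?thesis using assms by (auto simp: fe_space_def intro!: continuous_intros)
qed

lemma fe_space_derivative_on_cell:
  assumes "v \<in> fe_space T" "consecutive T p q" "t \<in> {p<..<q}"
  shows "(v has_real_derivative (v q - v p) / (q - p)) (at t)"
proof -
  obtain \<alpha> \<beta> where v: "\<forall>s\<in>{p..q}. v s = \<alpha> + \<beta> * s"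
    using assms unfolding fe_space_def by blast
  have "p < q" using assms(2) by (simp add: consecutive_def)
  then have \<beta>: "(v q - v p) / (q - p) = \<beta>" using v by (simp add: field_simps)
  have "((\<lambda>s. \<alpha> + \<beta> * s) has_real_derivative \<beta>) (at t)"
    by (auto intro!: derivative_eq_intros)
  then show ?thesis
    unfolding \<beta> using v assms(3)
    by (elim has_field_derivative_transform_within_open[where S = "{p<..<q}"]) auto
qed

lemma fe_space_DERIV_deriv:
  assumes "mesh T" "v \<in> fe_space T" "t \<in> cells T"
  shows "(v has_real_derivative deriv v t) (at t)"
proof -
  obtain p q where "consecutive T p q" "p < t" "t < q"
    using consecutive_around assms by blast
  then have "(v has_real_derivative (v q - v p) / (q - p)) (at t)"
    using fe_space_derivative_on_cell assms by auto
  then show ?thesis by (metis DERIV_imp_deriv)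
qed

section \<open>Bilinearity of the form\<close>

text \<open>The integrands are compared only on the cells; there both a finite element function and its
  derivative are continuous and bounded, which makes all products integrable whatever values
  \<open>deriv\<close> takes at the nodes.\<close>

definition bounded_continuous_on_cells :: "real set \<Rightarrow> (real \<Rightarrow> real) \<Rightarrow> bool" where
  "bounded_continuous_on_cells T f \<longleftrightarrow> continuous_on (cells T) f \<and> bounded (f ` cells T)"

lemma open_cells: "mesh T \<Longrightarrow> open (cells T)"
  by (simp add: cells_def mesh_def finite_imp_closed open_Diff)

lemma bounded_continuous_fe:
  assumes "mesh T" "v \<in> fe_space T"
  shows "bounded_continuous_on_cells T v"
proof -
  have c: "continuous_on {0..1} v" using assms by (simp add: fe_space_def)
  have s: "cells T \<subseteq> {0..1}" by (auto simp: cells_def)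
  have "bounded (v ` {0..1})"
    by (intro compact_imp_bounded compact_continuous_image c) auto
  then show ?thesis
    using c s bounded_subset[OF _ image_mono] continuous_on_subset
    unfolding bounded_continuous_on_cells_def by blast
qed

text \<open>On a cell the derivative is the slope of a chord between two nodes.  It is therefore locally
  constant, and as there are finitely many chords it takes finitely many values.\<close>

lemma bounded_continuous_deriv_fe:
  assumes "mesh T" "v \<in> fe_space T"
  shows "bounded_continuous_on_cells T (deriv v)"
  unfolding bounded_continuous_on_cells_def
proof
  let ?slopes = "(\<lambda>(p, q). (v q - v p) / (q - p)) ` (T \<times> T)"
  have slope: "deriv v s = (v q - v p) / (q - p)"
    if "consecutive T p q" "s \<in> {p<..<q}" for p q s
    using fe_space_derivative_on_cell[OF assms(2) that] by (rule DERIV_imp_deriv)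
  show "bounded (deriv v ` cells T)"
  proof (rule bounded_subset[OF finite_imp_bounded])
    show "finite ?slopes" using assms(1) by (simp add: mesh_def)
    show "deriv v ` cells T \<subseteq> ?slopes"
    proof
      fix y assume "y \<in> deriv v ` cells T"
      then obtain t where t: "t \<in> cells T" "y = deriv v t" by blast
      then obtain p q where pq: "consecutive T p q" "p < t" "t < q"
        using consecutive_around assms by blast
      then have "y = (v q - v p) / (q - p)" using slope t(2) by simp
      moreover have "(p, q) \<in> T \<times> T" using pq(1) by (auto simp: consecutive_def)
      ultimately show "y \<in> ?slopes" by (intro image_eqI[where x = "(p, q)"]) auto
    qed
  qed
  have "isCont (deriv v) t" if t: "t \<in> cells T" for t
  proof -
    obtain p q where pq: "consecutive T p q" "p < t" "t < q"
      using consecutive_around[OF assms(1) t] by blast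
    have "\<forall>\<^sub>F s in nhds t. s \<in> {p<..<q}"
      using pq by (intro eventually_nhds_in_open) auto
    then have "\<forall>\<^sub>F s in nhds t. deriv v s = (v q - v p) / (q - p)"
      by eventually_elim (rule slope[OF pq(1)])
    then show ?thesis by (subst isCont_cong) auto
  qed
  then show "continuous_on (cells T) (deriv v)"
    by (simp add: continuous_at_imp_continuous_on)
qed

lemma l2_inner_has_integral:
  assumes "mesh T" "bounded_continuous_on_cells T f" "bounded_continuous_on_cells T g"
  shows "((\<lambda>t. f t * g t) has_integral l2_inner f g) {0..1}"
proof -
  let ?h = "\<lambda>t. f t * g t"
  obtain A where A: "\<And>t. t \<in> cells T \<Longrightarrow> norm (f t) \<le> A"
    using assms(2) unfolding bounded_continuous_on_cells_def bounded_iff by auto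
  obtain B where B: "\<And>t. t \<in> cells T \<Longrightarrow> norm (g t) \<le> B"
    using assms(3) unfolding bounded_continuous_on_cells_def bounded_iff by auto
  have o: "open (cells T)" using assms(1) by (rule open_cells)
  have "cells T \<in> lmeasurable"
    by (rule lmeasurable_open[OF _ o])
      (auto simp: cells_def intro: bounded_subset[OF bounded_closed_interval[of 0 1]])
  then have "(\<lambda>t. A * B) integrable_on cells T"
    by (rule integrable_on_const)
  moreover have "continuous_on (cells T) ?h"
    using assms by (auto simp: bounded_continuous_on_cells_def intro!: continuous_intros)
  moreover have "norm (?h t) \<le> A * B" if "t \<in> cells T" for t
    unfolding norm_mult using A[OF that] B[OF that]
    by (intro mult_mono) (auto intro: order_trans[OF norm_ge_zero])
  ultimately have "?h absolutely_integrable_on cells T"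
    using o by (intro measurable_bounded_by_integrable_imp_absolutely_integrable[where g = "\<lambda>t. A * B"]
        continuous_imp_measurable_on_sets_lebesgue) auto
  then have "?h absolutely_integrable_on {0..1}"
  proof (rule absolutely_integrable_spike_set)
    show "negligible {t \<in> cells T - {0..1}. ?h t \<noteq> 0}"
      by (rule negligible_subset[OF negligible_empty]) (auto simp: cells_def)
    show "negligible {t \<in> {0..1} - cells T. ?h t \<noteq> 0}"
      by (rule negligible_subset[OF negligible_finite[of T]]) (use assms(1) in \<open>auto simp: cells_def mesh_def\<close>)
  qed
  from set_lebesgue_integral_eq_integral[OF this] show ?thesis
    unfolding l2_inner_def by (simp add: has_integral_integrable_integral)
qed

lemma has_integral_cong_cells:
  assumes "mesh T" "\<And>t. t \<in> cells T \<Longrightarrow> f t = g t" "(f has_integral y) {0..1}"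
  shows "(g has_integral y) {0..1}"
proof (rule has_integral_spike_finite[of T _ g f])
  show "g t = f t" if "t \<in> {0..1} - T" for t
  proof -
    have "t \<noteq> 0" "t \<noteq> 1" using that assms(1) by (auto simp: mesh_def)
    then show ?thesis using that assms(2)[of t] by (auto simp: cells_def)
  qed
qed (use assms in \<open>auto simp: mesh_def\<close>)

lemma l2_inner_lincomb_left:
  assumes "mesh T"
    and "bounded_continuous_on_cells T f" "bounded_continuous_on_cells T g"
    and "bounded_continuous_on_cells T h" "bounded_continuous_on_cells T k"
    and "\<And>t. t \<in> cells T \<Longrightarrow> k t = a * f t + d * g t"
  shows "l2_inner k h = a * l2_inner f h + d * l2_inner g h"
proof -
  have "((\<lambda>t. a * (f t * h t) + d * (g t * h t)) has_integral a * l2_inner f h + d * l2_inner g h) {0..1}"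
    by (intro has_integral_add has_integral_mult_right l2_inner_has_integral[OF assms(1)] assms)
  then have "((\<lambda>t. k t * h t) has_integral a * l2_inner f h + d * l2_inner g h) {0..1}"
    by (rule has_integral_cong_cells[OF assms(1), rotated]) (simp add: assms(6) algebra_simps)
  then show ?thesis
    using l2_inner_has_integral[OF assms(1,5,4)] has_integral_unique by blast
qed

lemma bilinear_form_lincomb_left:
  assumes "mesh T" "u \<in> fe_space T" "v \<in> fe_space T" "w \<in> fe_space T"
  shows "bilinear_form \<epsilon> b c (\<lambda>t. a * u t + d * v t) w
    = a * bilinear_form \<epsilon> b c u w + d * bilinear_form \<epsilon> b c v w"
proof -
  let ?z = "\<lambda>t. a * u t + d * v t"
  have z: "?z \<in> fe_space T" using assms by (intro fe_space_lincomb)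
  note bc = bounded_continuous_fe[OF assms(1)] bounded_continuous_deriv_fe[OF assms(1)]
  have D: "deriv ?z t = a * deriv u t + d * deriv v t" if "t \<in> cells T" for t
    by (intro DERIV_imp_deriv DERIV_add DERIV_cmult fe_space_DERIV_deriv[OF assms(1) _ that] assms)
  have "l2_inner (deriv ?z) (deriv w) = a * l2_inner (deriv u) (deriv w) + d * l2_inner (deriv v) (deriv w)"
    by (intro l2_inner_lincomb_left[OF assms(1)] bc D z assms)
  moreover have "l2_inner ?z h = a * l2_inner u h + d * l2_inner v h"
    if "bounded_continuous_on_cells T h" for h
    by (intro l2_inner_lincomb_left[OF assms(1)] bc z assms that refl)
  ultimately show ?thesis
    using bc(1)[OF assms(4)] bc(2)[OF assms(4)] unfolding bilinear_form_def by (simp add: algebra_simps)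
qed

section \<open>Coercivity and truncation\<close>

text \<open>The convection term drops out because \<open>v * v'\<close> is the derivative of \<open>v\<^sup>2 / 2\<close>, which is \<open>0\<close>
  at both ends.\<close>

lemma l2_inner_deriv_self_eq_0:
  assumes "mesh T" "v \<in> fe_space T"
  shows "l2_inner v (deriv v) = 0"
proof -
  have "((\<lambda>t. v t * deriv v t) has_integral (v 1)\<^sup>2 / 2 - (v 0)\<^sup>2 / 2) {0..1}"
  proof (rule fundamental_theorem_of_calculus_interior_strong[of T])
    show "finite T" using assms(1) by (simp add: mesh_def)
    show "continuous_on {0..1} (\<lambda>t. (v t)\<^sup>2 / 2)"
      using assms(2) by (auto simp: fe_space_def intro!: continuous_intros)
    fix t :: real assume "t \<in> {0<..<1} - T"
    then have "(v has_real_derivative deriv v t) (at t)"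
      using fe_space_DERIV_deriv assms by (simp add: cells_def)
    then have "((\<lambda>t. (v t)\<^sup>2 / 2) has_real_derivative v t * deriv v t) (at t)"
      by (auto intro!: derivative_eq_intros)
    then show "((\<lambda>t. (v t)\<^sup>2 / 2) has_vector_derivative v t * deriv v t) (at t)"
      by (simp add: has_real_derivative_iff_has_vector_derivative)
  qed simp
  moreover have "v 0 = 0" "v 1 = 0" using assms(2) by (auto simp: fe_space_def)
  ultimately have "((\<lambda>t. v t * deriv v t) has_integral 0) {0..1}" by simp
  then show ?thesis
    using l2_inner_has_integral[OF assms(1) bounded_continuous_fe[OF assms]
        bounded_continuous_deriv_fe[OF assms]]
    by (rule has_integral_unique[symmetric])
qed

text \<open>A nonzero slope on one cell already contributes a positive amount to the energy, so zero
  energy makes the function constant, and it starts at \<open>0\<close>.\<close>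

lemma fe_eq_0_if_energy_0:
  assumes "mesh T" "v \<in> fe_space T" "l2_inner (deriv v) (deriv v) = 0" "t \<in> {0..1}"
  shows "v t = 0"
proof (rule has_derivative_zero_unique_strong_interval[of T 0 1 v])
  show "finite T" using assms(1) by (simp add: mesh_def)
  show "continuous_on {0..1} v" "v 0 = 0" using assms(2) by (auto simp: fe_space_def)
  fix s :: real assume "s \<in> {0..1} - T"
  moreover from this have "s \<noteq> 0" "s \<noteq> 1" using assms(1) by (auto simp: mesh_def)
  ultimately have s: "s \<in> cells T" by (auto simp: cells_def)
  then obtain p q where pq: "consecutive T p q" "p < s" "s < q"
    using consecutive_around assms(1) by blast
  let ?\<beta> = "(v q - v p) / (q - p)"
  have *: "(v has_real_derivative ?\<beta>) (at r)" if "r \<in> {p<..<q}" for r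
    using that by (rule fe_space_derivative_on_cell[OF assms(2) pq(1)])
  have "((\<lambda>r. ?\<beta> * ?\<beta>) has_integral ?\<beta> * ?\<beta> * (q - p)) {p..q}"
    using has_integral_const_real[of "?\<beta> * ?\<beta>" p q] pq by (simp add: mult.commute)
  then have "((\<lambda>r. deriv v r * deriv v r) has_integral ?\<beta> * ?\<beta> * (q - p)) {p..q}"
    by (rule has_integral_spike_finite[of "{p, q}", rotated 2]) (auto simp: DERIV_imp_deriv[OF *])
  moreover have "((\<lambda>r. deriv v r * deriv v r) has_integral 0) {0..1}"
    using l2_inner_has_integral[OF assms(1)] bounded_continuous_deriv_fe[OF assms(1,2)] assms(3)
    by metis
  moreover have "{p..q} \<subseteq> {0..1}"
    using pq(1) assms(1) by (auto simp: consecutive_def mesh_def)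
  ultimately have "?\<beta> * ?\<beta> * (q - p) \<le> 0"
    by (elim has_integral_subset_le[rotated]) auto
  moreover have "0 < q - p" using pq by simp
  ultimately have "?\<beta> * ?\<beta> \<le> 0" by (metis mult_le_0_iff not_less)
  then have "?\<beta> = 0" by (metis mult_eq_0_iff order_antisym zero_le_square)
  then have "(v has_real_derivative 0) (at s)" using *[of s] pq by auto
  then show "(v has_derivative (\<lambda>h. 0)) (at s within {0..1})"
    by (auto simp: has_field_derivative_def lambda_zero[symmetric] intro: has_derivative_at_withinI)
qed (use assms in auto)

lemma coercive_form_eq_0:
  assumes "mesh T" "v \<in> fe_space T" "0 < \<epsilon>" "0 \<le> c" "bilinear_form \<epsilon> b c v v = 0" "t \<in> {0..1}"
  shows "v t = 0"
proof -
  note bc = bounded_continuous_fe[OF assms(1,2)] bounded_continuous_deriv_fe[OF assms(1,2)]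
  have "0 \<le> l2_inner v v" "0 \<le> l2_inner (deriv v) (deriv v)"
    using has_integral_nonneg[OF l2_inner_has_integral[OF assms(1)]] bc by auto
  moreover have "\<epsilon> * l2_inner (deriv v) (deriv v) + c * l2_inner v v = 0"
    using assms(5) l2_inner_deriv_self_eq_0[OF assms(1,2)] by (simp add: bilinear_form_def)
  ultimately have "l2_inner (deriv v) (deriv v) = 0"
    using assms(3,4) by (smt (verit) mult_nonneg_nonneg mult_pos_pos)
  then show ?thesis using fe_eq_0_if_energy_0 assms by blast
qed

definition truncate :: "real \<Rightarrow> (real \<Rightarrow> real) \<Rightarrow> real \<Rightarrow> real" where
  "truncate r z = (\<lambda>t. if t \<le> r then z t else 0)"

text \<open>Only the cells of \<open>T'\<close> to the left of \<open>r\<close> matter for the truncation, so it lies in the space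
  of any coarser mesh \<open>T\<close> that has the same nodes up to \<open>r\<close>.\<close>

lemma truncate_fe:
  assumes "z \<in> fe_space T'" "z r = 0" "r \<in> T" "r \<le> 1" "T \<subseteq> T'" "T' \<inter> {..r} \<subseteq> T" "0 \<le> r"
  shows "truncate r z \<in> fe_space T"
proof -
  have c: "continuous_on {0..1} z" using assms by (simp add: fe_space_def)
  have "continuous_on ({0..r} \<union> {r..1}) (truncate r z)"
    unfolding truncate_def using assms c
    by (intro continuous_on_If) (auto intro: continuous_on_subset)
  moreover have "{0..r} \<union> {r..1} = {0..1}" using assms by auto
  moreover have "\<exists>\<alpha> \<beta>. \<forall>t\<in>{p..q}. truncate r z t = \<alpha> + \<beta> * t" if pq: "consecutive T p q" for p q
  proof (cases "q \<le> r")
    case True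
    then have "consecutive T' p q" using pq assms(5,6) by (fastforce simp: consecutive_def)
    then obtain \<alpha> \<beta> where "\<forall>t\<in>{p..q}. z t = \<alpha> + \<beta> * t"
      using assms(1) unfolding fe_space_def by blast
    then have "\<forall>t\<in>{p..q}. truncate r z t = \<alpha> + \<beta> * t"
      using True by (auto simp: truncate_def)
    then show ?thesis by blast
  next
    case False
    then have "r \<le> p" using pq assms(3) by (force simp: consecutive_def)
    then have "truncate r z t = 0 + 0 * t" if "t \<in> {p..q}" for t
      using assms(2) that by (cases "t = r") (auto simp: truncate_def)
    then show ?thesis by blast
  qed
  ultimately show ?thesis
    using assms by (auto simp: fe_space_def truncate_def)
qed

text \<open>Beyond \<open>r\<close> the truncation \<open>v\<close> and its derivative are \<open>0\<close>, and before \<open>r\<close> they agree with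
  those of \<open>z\<close>; so \<open>a(z, v) = a(v, v)\<close>.\<close>

lemma vanishes_if_orthogonal_to_truncation:
  assumes "mesh T" "z \<in> fe_space T" "r \<in> T" "z r = 0" "0 < \<epsilon>" "0 \<le> c"
    and "bilinear_form \<epsilon> b c z (truncate r z) = 0" "t \<in> {0..r}"
  shows "z t = 0"
proof -
  let ?v = "truncate r z"
  have r: "0 \<le> r" "r \<le> 1" using assms by (auto simp: mesh_def)
  have v: "?v \<in> fe_space T" using assms r by (intro truncate_fe[of z T]) auto
  have D: "deriv ?v s = (if s \<le> r then deriv z s else 0)" if s: "s \<in> cells T" for s
  proof (rule DERIV_imp_deriv)
    have "s \<noteq> r" using s assms(3) by (auto simp: cells_def)
    show "(?v has_real_derivative (if s \<le> r then deriv z s else 0)) (at s)"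
    proof (cases "s < r")
      case True
      have "(z has_real_derivative deriv z s) (at s)"
        using fe_space_DERIV_deriv[OF assms(1,2) s] .
      then have "(?v has_real_derivative deriv z s) (at s)"
        by (rule has_field_derivative_transform_within_open[where S = "{..<r}"])
          (use True in \<open>auto simp: truncate_def\<close>)
      then show ?thesis using True by simp
    next
      case False
      have "((\<lambda>_. 0) has_real_derivative 0) (at s)" by simp
      then have "(?v has_real_derivative 0) (at s)"
        by (rule has_field_derivative_transform_within_open[where S = "{r<..}"])
          (use False \<open>s \<noteq> r\<close> in \<open>auto simp: truncate_def\<close>)
      then show ?thesis using False \<open>s \<noteq> r\<close> by simp
    qed
  qed
  have V: "?v s = (if s \<le> r then z s else 0)" for s by (simp add: truncate_def)
  note bc = bounded_continuous_fe[OF assms(1)] bounded_continuous_deriv_fe[OF assms(1)]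
  have eq: "l2_inner f g = l2_inner f' g"
    if "bounded_continuous_on_cells T f" "bounded_continuous_on_cells T f'"
      "bounded_continuous_on_cells T g" "\<And>s. s \<in> cells T \<Longrightarrow> f s * g s = f' s * g s" for f f' g
    using has_integral_cong_cells[OF assms(1) that(4) l2_inner_has_integral[OF assms(1) that(1,3)]]
      l2_inner_has_integral[OF assms(1) that(2,3)] has_integral_unique by blast
  have "bilinear_form \<epsilon> b c z ?v = bilinear_form \<epsilon> b c ?v ?v"
    unfolding bilinear_form_def
    using eq[OF bc(2)[OF assms(2)] bc(2)[OF v] bc(2)[OF v]]
      eq[OF bc(1)[OF assms(2)] bc(1)[OF v] bc(2)[OF v]]
      eq[OF bc(1)[OF assms(2)] bc(1)[OF v] bc(1)[OF v]]
    by (simp add: D V)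
  then have "?v t = 0"
    using coercive_form_eq_0[OF assms(1) v assms(5,6), of b t] assms(7,8) r by auto
  then show ?thesis using assms(8) by (simp add: truncate_def)
qed

section \<open>Intersections of finite element solutions\<close>

text \<open>Both differences satisfy the same homogeneous discrete equations on \<open>[0, r]\<close>, hence so do
  their linear combinations, and such a function is determined by its value at \<open>r\<close>.  Taking
  \<open>\<alpha>\<close> or \<open>\<beta>\<close> to be \<open>0\<close> gives the statement for a single refinement.\<close>

lemma refinement_combination_vanishes:
  assumes "mesh T" "r \<in> T"
    and "finite S" "S \<subseteq> {r<..<1}" "finite S'" "S' \<subseteq> {r<..<1}"
    and "0 < \<epsilon>" "0 \<le> c"
    and u: "fe_solution \<epsilon> b c f T u"
    and u1: "fe_solution \<epsilon> b c f (T \<union> S) u1"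
    and u2: "fe_solution \<epsilon> b c f (T \<union> S') u2"
    and at_r: "\<alpha> * (u1 r - u r) + \<beta> * (u2 r - u r) = 0"
    and "t \<in> {0..r}"
  shows "\<alpha> * (u1 t - u t) + \<beta> * (u2 t - u t) = 0"
proof -
  have r: "0 \<le> r" "r \<le> 1" using assms by (auto simp: mesh_def)
  \<comment> \<open>\<open>u1\<close> and \<open>u2\<close> live on unrelated refinements; the common one makes the combination a finite
    element function, while its truncation at \<open>r\<close> lies even in the coarse space.\<close>
  let ?T = "T \<union> (S \<union> S')"
  have m1: "mesh (T \<union> S)" and m2: "mesh (T \<union> S')" and m: "mesh ?T"
    using assms(3-6) r by (auto intro!: mesh_Un[OF assms(1)])
  have uT: "u \<in> fe_space T" and u1T: "u1 \<in> fe_space (T \<union> S)" and u2T: "u2 \<in> fe_space (T \<union> S')"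
    using u u1 u2 by (auto simp: fe_solution_def)
  have fine: "u \<in> fe_space ?T" "u1 \<in> fe_space ?T" "u2 \<in> fe_space ?T"
    using fe_space_mono[OF assms(1) m _ uT] fe_space_mono[OF m1 m _ u1T]
      fe_space_mono[OF m2 m _ u2T] by auto
  let ?w1 = "\<lambda>t. 1 * u1 t + (-1) * u t" and ?w2 = "\<lambda>t. 1 * u2 t + (-1) * u t"
  let ?z = "\<lambda>t. \<alpha> * ?w1 t + \<beta> * ?w2 t"
  have w: "?w1 \<in> fe_space ?T" "?w2 \<in> fe_space ?T"
    using fine by (blast intro: fe_space_lincomb)+
  then have z: "?z \<in> fe_space ?T" by (rule fe_space_lincomb)
  have zr: "?z r = 0" using at_r by simp
  let ?v = "truncate r ?z"
  have v: "?v \<in> fe_space T"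
    by (rule truncate_fe[of ?z ?T]) (use assms r z zr in auto)
  then have v': "?v \<in> fe_space ?T" "?v \<in> fe_space (T \<union> S)" "?v \<in> fe_space (T \<union> S')"
    using fe_space_mono[OF assms(1) m] fe_space_mono[OF assms(1) m1] fe_space_mono[OF assms(1) m2]
    by blast+
  have "bilinear_form \<epsilon> b c u ?v = l2_inner f ?v" "bilinear_form \<epsilon> b c u1 ?v = l2_inner f ?v"
    "bilinear_form \<epsilon> b c u2 ?v = l2_inner f ?v"
    using u u1 u2 v v' unfolding fe_solution_def by blast+
  then have "bilinear_form \<epsilon> b c ?z ?v = 0"
    using bilinear_form_lincomb_left[OF m w v'(1), of \<epsilon> b c]
      bilinear_form_lincomb_left[OF m fine(2,1) v'(1), of \<epsilon> b c 1 "-1"]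
      bilinear_form_lincomb_left[OF m fine(3,1) v'(1), of \<epsilon> b c 1 "-1"] by simp
  then have "?z t = 0"
    using vanishes_if_orthogonal_to_truncation[OF m z _ zr] assms by blast
  then show ?thesis by simp
qed

lemma graph_over_Int:
  "graph_over I u \<inter> graph_over I v = (\<lambda>t. (t, u t)) ` {t\<in>I. u t = v t}"
  by (auto simp: graph_over_def)

lemma finite_new_nodes: "new_nodes p m s \<Longrightarrow> finite (s ` {1..m}) \<and> s ` {1..m} \<subseteq> {p<..<1}"
  by (simp add: new_nodes_def)

theorem theorem3p3:
  fixes \<epsilon> b c :: real and f :: "real \<Rightarrow> real"
    and n :: nat and x :: "nat \<Rightarrow> real" and u_n :: "real \<Rightarrow> real"
    and m m' :: nat and s s' :: "nat \<Rightarrow> real" and u_nm u_nm' :: "real \<Rightarrow> real"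
    and i :: nat and Q :: "real \<times> real"
  assumes "0 < \<epsilon>" and "b \<le> 0" and "0 \<le> c" and "\<not> (b = 0 \<and> c = 0)"
    and "l2_function f"
    and "2 \<le> n" and "grid n x"
    and "fe_solution \<epsilon> b c f (grid_nodes n x) u_n"
    and "new_nodes (x n) m s"
    and "fe_solution \<epsilon> b c f (grid_nodes n x \<union> s ` {1..m}) u_nm"
    and "new_nodes (x n) m' s'"
    and "fe_solution \<epsilon> b c f (grid_nodes n x \<union> s' ` {1..m'}) u_nm'"
    and "2 \<le> i" and "i \<le> n"
    and "graph_over {x (i - 1)<..<x i} u_n \<inter> graph_over {x (i - 1)<..<x i} u_nm = {Q}"
    and "graph_over {x (i - 1)<..<x i} u_n \<noteq> graph_over {x (i - 1)<..<x i} u_nm'"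
  shows "graph_over {x (i - 1)<..<x i} u_n \<inter> graph_over {x (i - 1)<..<x i} u_nm' = {Q}"
proof -
  let ?I = "{x (i - 1)<..<x i}" and ?r = "x n" and ?T = "grid_nodes n x"
  have T: "mesh ?T" and r: "?r \<in> ?T"
    using mesh_grid_nodes[OF assms(7)] by (auto simp: grid_nodes_def)
  have mono: "strict_mono_on {0..n+1} x" and x0: "x 0 = 0" using assms(7) by (auto simp: grid_def)
  have "0 < x (i - 1)" "x (i - 1) < x i" "x i \<le> ?r"
    using strict_mono_onD[OF mono, of 0 "i - 1"] strict_mono_onD[OF mono, of "i - 1" i]
      strict_mono_on_leD[OF mono, of i n] x0 assms(13,14) by auto
  then have I: "?I \<subseteq> {0..?r}" and infI: "infinite ?I"
    by (auto simp: infinite_Ioo)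
  note S = finite_new_nodes[OF assms(9)] and S' = finite_new_nodes[OF assms(11)]
  let ?w = "\<lambda>t. u_nm t - u_n t" and ?w' = "\<lambda>t. u_nm' t - u_n t"
  have vanish: "\<alpha> * ?w t + \<beta> * ?w' t = 0"
    if "\<alpha> * ?w ?r + \<beta> * ?w' ?r = 0" "t \<in> ?I" for \<alpha> \<beta> t
    using refinement_combination_vanishes[OF T r _ _ _ _ assms(1,3,8,10,12) that(1)] S S' I that(2)
    by blast
  have "?w ?r \<noteq> 0"
  proof
    assume "?w ?r = 0"
    then have "?w t = 0" if "t \<in> ?I" for t
      using vanish[of 1 0 t] that by simp
    then have "{t\<in>?I. u_n t = u_nm t} = ?I" by auto
    moreover have "inj_on (\<lambda>t. (t, u_n t)) ?I" by (auto simp: inj_on_def)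
    ultimately have "infinite (graph_over ?I u_n \<inter> graph_over ?I u_nm)"
      using infI by (simp add: graph_over_Int finite_image_iff)
    then show False using assms(15) by simp
  qed
  moreover have "?w' ?r \<noteq> 0"
  proof
    assume "?w' ?r = 0"
    then have "u_nm' t = u_n t" if "t \<in> ?I" for t
      using vanish[of 0 1 t] that by simp
    then have "graph_over ?I u_n = graph_over ?I u_nm'" by (auto simp: graph_over_def)
    then show False using assms(16) by simp
  qed
  moreover have "?w' ?r * ?w t = ?w ?r * ?w' t" if "t \<in> ?I" for t
  proof -
    have "?w' ?r * ?w ?r + (- ?w ?r) * ?w' ?r = 0" by (simp add: algebra_simps)
    from vanish[OF this that] show ?thesis by (simp add: algebra_simps)
  qed
  ultimately have "u_n t = u_nm t \<longleftrightarrow> u_n t = u_nm' t" if "t \<in> ?I" for t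
    using that by (metis eq_iff_diff_eq_0 mult_eq_0_iff)
  then have "{t\<in>?I. u_n t = u_nm t} = {t\<in>?I. u_n t = u_nm' t}" by auto
  then show ?thesis using assms(15) unfolding graph_over_Int by metis
qed

end
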